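(* Let $G=(V,E)$ be a finite simple graph which is a geometric graph of dimension $d\ge 1$, and let $f:V\to\mathbb{R}$ be an injective function. Then $$ \chi(G)=\sum_{x\in V}\left(\frac{1+(-1)^d}{2}-\frac{\chi(B_f(x))}{2}\right). $$ In particular, if $d$ is odd then $\chi(G)=-\sum_{x\in V}\chi(B_f(x))/2$, and if $d$ is even then $\chi(G)=\sum_{x\in V}\bigl(1-\chi(B_f(x))/2\bigr)$.
   Context: For a finite simple graph $H$, let $v_k(H)$ be the number of complete subgraphs $K_{k+1}$ of $H$; the Euler characteristic is $\chi(H)=\sum_{k\ge 0}(-1)^k v_k(H)$ (so $\chi(\emptyset)=0$). For a vertex $x$, the unit sphere $S(x)$ is the subgraph induced by the neighbors of $x$. Dimension (inductive): $\dim(\emptyset)=-1$; for a vertex $x$ of a nonempty graph $\dim(x)=1+\dim(S(x))$; and $\dim(H)$ is the average of $\dim(x)$ over the vertices $x$ of $H$. Geometric graphs (inductive): a graph is a geometric graph of dimension $1$ if $\dim(x)=1$ and $\chi(S(x))=2$ for every vertex $x$. For $d\ge2$, a graph is a geometric graph of dimension $d$ if $\dim(x)=d$ for every vertex $x$ and each unit sphere $S(x)$ is a geometric graph of dimension $d-1$ satisfying $\chi(S(x))=1-(-1)^d$. Hypersurface graph: let $H$ be a finite simple graph and $g$ a nowhere zero real function on its vertices. A subgraph of $H$ is called mixed if it contains both a vertex with $g>0$ and a vertex with $g<0$. The graph $H_g$ has as vertices the mixed edges of $H$; two distinct mixed edges are joined by an edge of $H_g$ if and only if they lie in a common mixed triangle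 of $H$ (each mixed triangle contains exactly two mixed edges). Completion: for a mixed complete subgraph $\sigma$ of $H$ with $s$ vertices where $g>0$ and $t$ vertices where $g<0$, the mixed edges of $\sigma$ induce in $H_g$ a graph isomorphic to the Cartesian product $K_s\times K_t$ (two pairs adjacent iff they agree in one coordinate and are adjacent in the other). The completion $H_g'$ of $H_g$ is obtained by a pyramid construction over each face with $s,t\ge 2$, in order of increasing size of $\sigma$: for every mixed complete subgraph $\sigma$ of $H$ with $s\ge2$ and $t\ge 2$ a new vertex $z_\sigma$ is added, and it is joined by edges to all mixed edges of $\sigma$ (vertices of $H_g$) and to all $z_\tau$ with $\tau\subsetneq\sigma$ a mixed complete subgraph having at least two vertices of each sign. No other vertices or edges are added. Given $G$, injective $f$ and $x\in V$, let $g(y)=f(y)-f(x)$ for $y\in S(x)$ (nowhere zero). Then $A_f(x)=S(x)_g$ and $B_f(x)$ is the completion $A_f(x)'$ of $A_f(x)$. *)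

theory Defs
  imports Complex_Main
begin

type_synonym 'a graph = "'a set \<times> 'a set set"

abbreviation verts :: "'a graph \<Rightarrow> 'a set" where "verts \<equiv> fst"
abbreviation edges :: "'a graph \<Rightarrow> 'a set set" where "edges \<equiv> snd"

definition finite_simple_graph :: "'a graph \<Rightarrow> bool" where
  "finite_simple_graph G \<longleftrightarrow>
     finite (verts G) \<and> (\<forall>e\<in>edges G. e \<subseteq> verts G \<and> card e = 2)"

definition induced :: "'a graph \<Rightarrow> 'a set \<Rightarrow> 'a graph" where
  "induced G W = (W, {e \<in> edges G. e \<subseteq> W})"

text \<open>
  The condition \<open>y \<noteq> x\<close> is automatic in a simple graph. It is kept so that the recursion
  defining the dimension terminates on arbitrary pairs of sets.
\<close>

definition unit_sphere :: "'a graph \<Rightarrow> 'a \<Rightarrow> 'a graph" where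
  "unit_sphere G x = induced G {y \<in> verts G. y \<noteq> x \<and> {x, y} \<in> edges G}"

text \<open>A complete subgraph is represented by its vertex set.\<close>

definition complete_sub :: "'a graph \<Rightarrow> 'a set \<Rightarrow> bool" where
  "complete_sub G W \<longleftrightarrow>
     W \<subseteq> verts G \<and> (\<forall>x\<in>W. \<forall>y\<in>W. x \<noteq> y \<longrightarrow> {x, y} \<in> edges G)"

definition num_complete :: "nat \<Rightarrow> 'a graph \<Rightarrow> nat" where
  "num_complete k G = card {W. complete_sub G W \<and> card W = k + 1}"

text \<open>No complete subgraph has more than \<open>card (verts G)\<close> vertices, so the sum may stop there.\<close>

definition euler_char :: "'a graph \<Rightarrow> int" where
  "euler_char G = (\<Sum>k<card (verts G). (-1) ^ k * int (num_complete k G))"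

text \<open>The value on graphs with infinitely many vertices is a dummy.\<close>

function graph_dim :: "'a graph \<Rightarrow> real" where
  "graph_dim G =
     (if finite (verts G) \<and> verts G \<noteq> {}
      then (\<Sum>x\<in>verts G. 1 + graph_dim (unit_sphere G x)) / real (card (verts G))
      else - 1)"
  by pat_completeness auto
termination
proof (relation "measure (\<lambda>G. card (verts G))", goal_cases)
  case 1
  show ?case by simp
next
  case (2 G x)
  then have "verts (unit_sphere G x) \<subset> verts G"
    by (auto simp: unit_sphere_def induced_def)
  with 2 show ?case
    by (simp add: psubset_card_mono)
qed

declare graph_dim.simps [simp del]

definition vertex_dim :: "'a graph \<Rightarrow> 'a \<Rightarrow> real" where
  "vertex_dim G x = 1 + graph_dim (unit_sphere G x)"

inductive geometric_graph :: "nat \<Rightarrow> 'a graph \<Rightarrow> bool" where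
  one: "(\<forall>x\<in>verts G. vertex_dim G x = 1 \<and> euler_char (unit_sphere G x) = 2)
    \<Longrightarrow> geometric_graph 1 G"
| step: "d \<ge> 2 \<Longrightarrow>
    (\<forall>x\<in>verts G. vertex_dim G x = real d \<and> geometric_graph (d - 1) (unit_sphere G x) \<and>
       euler_char (unit_sphere G x) = 1 - (-1) ^ d)
    \<Longrightarrow> geometric_graph d G"

definition mixed :: "('a \<Rightarrow> real) \<Rightarrow> 'a set \<Rightarrow> bool" where
  "mixed g W \<longleftrightarrow> (\<exists>x\<in>W. g x > 0) \<and> (\<exists>x\<in>W. g x < 0)"

definition hypersurface :: "'a graph \<Rightarrow> ('a \<Rightarrow> real) \<Rightarrow> 'a set graph" where
  "hypersurface H g =
     ({e \<in> edges H. mixed g e},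
      {{e, e'} | e e'. e \<in> edges H \<and> mixed g e \<and> e' \<in> edges H \<and> mixed g e' \<and> e \<noteq> e' \<and>
         (\<exists>T. complete_sub H T \<and> card T = 3 \<and> mixed g T \<and> e \<subseteq> T \<and> e' \<subseteq> T)})"

text \<open>
  The complete subgraphs that receive a pyramid point. Two vertices of each sign make them mixed.
\<close>

definition pyramid_bases :: "'a graph \<Rightarrow> ('a \<Rightarrow> real) \<Rightarrow> 'a set set" where
  "pyramid_bases H g =
     {\<sigma>. complete_sub H \<sigma> \<and> card {x \<in> \<sigma>. g x > 0} \<ge> 2 \<and> card {x \<in> \<sigma>. g x < 0} \<ge> 2}"

datatype 'a completion_vertex = Mixed_Edge "'a set" | Apex "'a set"

text \<open>
  The result of the successive pyramid constructions, written down at once: an apex is joined to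
  the mixed edges and to the earlier apexes lying in its base.
\<close>

definition completion :: "'a graph \<Rightarrow> ('a \<Rightarrow> real) \<Rightarrow> 'a completion_vertex graph" where
  "completion H g =
     (Mixed_Edge ` verts (hypersurface H g) \<union> Apex ` pyramid_bases H g,
      {{Mixed_Edge e, Mixed_Edge e'} | e e'. {e, e'} \<in> edges (hypersurface H g)} \<union>
      {{Mixed_Edge e, Apex \<sigma>} | e \<sigma>.
         e \<in> verts (hypersurface H g) \<and> \<sigma> \<in> pyramid_bases H g \<and> e \<subseteq> \<sigma>} \<union>
      {{Apex \<tau>, Apex \<sigma>} | \<tau> \<sigma>.
         \<tau> \<in> pyramid_bases H g \<and> \<sigma> \<in> pyramid_bases H g \<and> \<tau> \<subset> \<sigma>})"

definition A_graph :: "'a graph \<Rightarrow> ('a \<Rightarrow> real) \<Rightarrow> 'a \<Rightarrow> 'a set graph" where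
  "A_graph G f x = hypersurface (unit_sphere G x) (\<lambda>y. f y - f x)"

definition B_graph :: "'a graph \<Rightarrow> ('a \<Rightarrow> real) \<Rightarrow> 'a \<Rightarrow> 'a completion_vertex graph" where
  "B_graph G f x = completion (unit_sphere G x) (\<lambda>y. f y - f x)"

end

theory Submission
  imports Defs
begin

text \<open>
  Counted with the empty one, complete subgraphs \<open>W\<close> weighted by \<open>(-1) ^ card W\<close> sum to
  \<open>1 - \<chi>\<close>. Splitting a nonempty complete subgraph of \<open>G\<close> into its \<open>f\<close>-maximal vertex \<open>x\<close> and a
  complete subgraph of the part of \<open>S(x)\<close> where \<open>f < f x\<close> gives a Poincare-Hopf formula for
  \<open>\<chi>(G)\<close>; average those for \<open>f\<close> and \<open>- f\<close>. The complete subgraphs of \<open>S(x)\<close> missing from the two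
  parts are the mixed ones, and they contribute \<open>\<chi>(B\<^sub>f(x))\<close>: group the complete subgraphs of the
  completion by the union \<open>\<sigma>\<close> of the sets carried by their vertices. If \<open>\<sigma>\<close> has only one vertex of
  some sign, exactly one of them has union \<open>\<sigma>\<close>, namely a row or column with \<open>card \<sigma> - 1\<close> vertices.
  Otherwise they are the cones from the apex over \<open>\<sigma>\<close>, and are counted by induction on \<open>card \<sigma>\<close>.
\<close>

section \<open>Alternating sums over families of sets\<close>

definition alternating_sum :: "'a set set \<Rightarrow> int" where
  "alternating_sum \<A> = (\<Sum>W\<in>\<A>. (-1) ^ card W)"

text \<open>Fixing one element \<open>a\<close> pairs each subset avoiding \<open>a\<close> with the
  one obtained by adding \<open>a\<close>, and the two have opposite signs.\<close>

lemma alternating_sum_Pow: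
  assumes "finite S" "S \<noteq> {}"
  shows "alternating_sum (Pow S) = 0"
proof -
  obtain a T where S: "S = insert a T" "a \<notin> T" "finite T"
    using assms by (metis all_not_in_conv finite_insert mk_disjoint_insert)
  have inj: "inj_on (insert a) (Pow T)"
    using S(2) by (auto simp: inj_on_def)
  have "alternating_sum (Pow S) = alternating_sum (Pow T) + alternating_sum (insert a ` Pow T)"
    unfolding alternating_sum_def S(1) Pow_insert using S
    by (intro sum.union_disjoint) auto
  also have "alternating_sum (insert a ` Pow T) = (\<Sum>W\<in>Pow T. - ((-1) ^ card W))"
    unfolding alternating_sum_def sum.reindex[OF inj] o_def
  proof (rule sum.cong[OF refl])
    fix W assume "W \<in> Pow T"
    then have "finite W" "a \<notin> W" using S finite_subset by auto
    then show "(- 1) ^ card (insert a W) = - ((- 1 :: int) ^ card W)" by simp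
  qed
  finally show ?thesis by (simp add: alternating_sum_def sum_negf)
qed

text \<open>Since \<open>g\<close> vanishes on no member, the three subfamilies cover the family.
  Only the empty set is counted twice, being vacuously of both signs; the 1 on the left pays for
  this.\<close>

lemma alternating_sum_split_by_sign:
  assumes "finite \<A>" "{} \<in> \<A>" "\<And>W x. W \<in> \<A> \<Longrightarrow> x \<in> W \<Longrightarrow> g x \<noteq> (0::real)"
  shows "alternating_sum \<A> + 1 =
           alternating_sum {W \<in> \<A>. \<forall>x\<in>W. g x > 0} + alternating_sum {W \<in> \<A>. \<forall>x\<in>W. g x < 0} +
           alternating_sum {W \<in> \<A>. mixed g W}"
proof -
  let ?P = "{W \<in> \<A>. \<forall>x\<in>W. g x > 0}" and ?N = "{W \<in> \<A>. \<forall>x\<in>W. g x < 0}"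
    and ?M = "{W \<in> \<A>. mixed g W}"
  have "(\<forall>x\<in>W. g x > 0) \<or> (\<forall>x\<in>W. g x < 0) \<or> mixed g W" if "W \<in> \<A>" for W
    using assms(3)[OF that] unfolding mixed_def by (meson linorder_neqE_linordered_idom)
  then have \<A>: "\<A> = ?P \<union> ?N \<union> ?M" by blast
  have empty: "?P \<inter> ?N = {{}}"
    using assms(2) by (auto) (metis all_not_in_conv order_less_asym)
  have "alternating_sum \<A> = alternating_sum (?P \<union> ?N) + alternating_sum ?M"
    unfolding alternating_sum_def using assms(1)
    by (subst \<A>, intro sum.union_disjoint) (auto simp: mixed_def dest: order_less_asym)
  moreover have "alternating_sum (?P \<union> ?N) + 1 = alternating_sum ?P + alternating_sum ?N"
    unfolding alternating_sum_def using assms(1) empty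
      sum.union_inter[of ?P ?N "\<lambda>W. (-1::int) ^ card W"] by simp
  ultimately show ?thesis by simp
qed

text \<open>Split \<open>Pow \<sigma>\<close> by sign: the whole power set and those of the positive
  and the negative part all sum to 0, so the mixed subsets sum to 1. Taking out
  \<open>\<sigma>\<close> itself leaves the claim.\<close>

lemma alternating_sum_mixed_subsets:
  assumes "finite \<sigma>" "\<And>x. x \<in> \<sigma> \<Longrightarrow> g x \<noteq> 0" "mixed g \<sigma>"
  shows "alternating_sum {\<tau>. \<tau> \<subset> \<sigma> \<and> mixed g \<tau>} = 1 - (-1) ^ card \<sigma>"
proof -
  have "{W \<in> Pow \<sigma>. \<forall>x\<in>W. g x > 0} = Pow {x \<in> \<sigma>. g x > 0}"
    "{W \<in> Pow \<sigma>. \<forall>x\<in>W. g x < 0} = Pow {x \<in> \<sigma>. g x < 0}" by auto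
  moreover have "{x \<in> \<sigma>. g x > 0} \<noteq> {}" "{x \<in> \<sigma>. g x < 0} \<noteq> {}" "\<sigma> \<noteq> {}"
    using assms(3) by (auto simp: mixed_def)
  ultimately have "alternating_sum {W \<in> Pow \<sigma>. mixed g W} = 1"
    using alternating_sum_split_by_sign[of "Pow \<sigma>" g] assms(1,2)
    by (simp add: alternating_sum_Pow subset_iff)
  moreover have "{W \<in> Pow \<sigma>. mixed g W} = insert \<sigma> {\<tau>. \<tau> \<subset> \<sigma> \<and> mixed g \<tau>}"
    using assms(3) by auto
  moreover have "finite {\<tau>. \<tau> \<subset> \<sigma> \<and> mixed g \<tau>}"
    by (rule finite_subset[of _ "Pow \<sigma>"]) (use assms(1) in auto)
  ultimately show ?thesis by (simp add: alternating_sum_def)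
qed

section \<open>Complete subgraphs and the Euler characteristic\<close>

lemma finite_complete_subs:
  assumes "finite (verts G)"
  shows "finite {W. complete_sub G W}"
  by (rule finite_subset[of _ "Pow (verts G)"]) (use assms in \<open>auto simp: complete_sub_def\<close>)

lemma complete_sub_empty: "complete_sub G {}"
  by (simp add: complete_sub_def)

lemma complete_sub_subset: "complete_sub G W \<Longrightarrow> U \<subseteq> W \<Longrightarrow> complete_sub G U"
  unfolding complete_sub_def by blast

lemma finite_complete_sub: "finite (verts G) \<Longrightarrow> complete_sub G W \<Longrightarrow> finite W"
  unfolding complete_sub_def using finite_subset by blast

text \<open>A complete subgraph counted by \<open>num_complete k\<close> has \<open>k + 1\<close>
  vertices, hence the change of sign.\<close>

lemma euler_char_eq_alternating_sum:
  assumes fin: "finite (verts G)"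
  shows "euler_char G = - alternating_sum {W. complete_sub G W \<and> W \<noteq> {}}"
proof -
  let ?C = "{W. complete_sub G W \<and> W \<noteq> {}}"
  have finC: "finite ?C" by (rule finite_subset[OF _ finite_complete_subs[OF fin]]) auto
  \<comment> \<open>The first bound makes the truncated subtraction \<open>card W - 1\<close> exact;
    the second shows that the range of \<open>k\<close> in \<open>euler_char\<close> misses no
    complete subgraph.\<close>
  have card: "1 \<le> card W" "card W - 1 < card (verts G)" if "W \<in> ?C" for W
  proof -
    have "finite W" "W \<subseteq> verts G" using that fin by (auto simp: complete_sub_def finite_subset)
    then have "card W \<le> card (verts G)" "card W \<noteq> 0" using fin that by (auto simp: card_mono)
    then show "1 \<le> card W" "card W - 1 < card (verts G)" by auto
  qed
  have "(-1) ^ k * int (num_complete k G) =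
      (\<Sum>W | W \<in> ?C \<and> card W - 1 = k. - ((-1) ^ card W))" for k
  proof -
    have "{W. complete_sub G W \<and> card W = k + 1} = {W. W \<in> ?C \<and> card W - 1 = k}"
      using card by fastforce
    moreover have "(\<Sum>W | W \<in> ?C \<and> card W - 1 = k. - ((-1) ^ card W))
      = (\<Sum>W | W \<in> ?C \<and> card W - 1 = k. (-1::int) ^ k)"
    proof (rule sum.cong[OF refl])
      fix W assume "W \<in> {W. W \<in> ?C \<and> card W - 1 = k}"
      then have "card W = Suc k" using card[of W] by auto
      then show "- ((-1) ^ card W) = (-1::int) ^ k" by simp
    qed
    ultimately show ?thesis by (simp add: num_complete_def)
  qed
  then have "euler_char G =
      (\<Sum>k<card (verts G). \<Sum>W | W \<in> ?C \<and> card W - 1 = k. - ((-1) ^ card W))"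
    unfolding euler_char_def by simp
  also have "\<dots> = (\<Sum>W\<in>?C. - ((-1) ^ card W))"
    by (rule sum.group[OF finC]) (use card in auto)
  finally show ?thesis by (simp add: alternating_sum_def sum_negf)
qed

lemma euler_char_eq_one_minus:
  assumes fin: "finite (verts G)"
  shows "euler_char G = 1 - alternating_sum {W. complete_sub G W}"
proof -
  have "{W. complete_sub G W} = insert {} {W. complete_sub G W \<and> W \<noteq> {}}"
    by (auto simp: complete_sub_empty)
  moreover have "finite {W. complete_sub G W \<and> W \<noteq> {}}"
    by (rule finite_subset[OF _ finite_complete_subs[OF fin]]) auto
  ultimately show ?thesis
    unfolding euler_char_eq_alternating_sum[OF fin] by (simp add: alternating_sum_def)
qed

section \<open>Unit spheres and the Poincare-Hopf formula\<close>

lemma finite_simple_graph_unit_sphere: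
  "finite_simple_graph G \<Longrightarrow> finite_simple_graph (unit_sphere G x)"
  by (auto simp: finite_simple_graph_def unit_sphere_def induced_def)

lemma complete_sub_unit_sphere:
  assumes "x \<in> verts G"
  shows "complete_sub (unit_sphere G x) W \<longleftrightarrow> x \<notin> W \<and> complete_sub G (insert x W)"
  using assms
  by (auto simp: complete_sub_def unit_sphere_def induced_def insert_commute)

text \<open>The pairs \<open>(x, W)\<close> with \<open>W\<close> in the lower part of the unit
  sphere of \<open>x\<close> correspond to the nonempty complete subgraphs
  \<open>insert x W\<close>. The extra vertex flips the sign, which cancels the sign in
  \<open>euler_char_eq_alternating_sum\<close>.\<close>

lemma poincare_hopf:
  fixes f :: "'a \<Rightarrow> real"
  assumes fin: "finite (verts G)" and inj: "inj_on f (verts G)"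
  shows "euler_char G =
    (\<Sum>x\<in>verts G. alternating_sum {W. complete_sub (unit_sphere G x) W \<and> (\<forall>y\<in>W. f y - f x < 0)})"
proof -
  let ?C = "{W. complete_sub G W \<and> W \<noteq> {}}"
  let ?L = "\<lambda>x. {W. complete_sub (unit_sphere G x) W \<and> (\<forall>y\<in>W. f y - f x < 0)}"
  define top where "top W = (SOME x. x \<in> W \<and> (\<forall>y\<in>W. f y \<le> f x))" for W
  have top: "top W \<in> W \<and> (\<forall>y\<in>W. f y \<le> f (top W))" if "W \<in> ?C" for W
  proof -
    have W: "finite W" "W \<noteq> {}" using that finite_complete_sub[OF fin] by auto
    then have "\<exists>x\<in>W. f x = Max (f ` W)" by (metis (mono_tags) Max_in finite_imageI image_iff image_is_empty)
    then have "\<exists>x. x \<in> W \<and> (\<forall>y\<in>W. f y \<le> f x)" using W(1) by (metis Max_ge finite_imageI imageI)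
    then show ?thesis unfolding top_def by (rule someI_ex)
  qed
  \<comment> \<open>Injectivity makes the maximum strict, so that what remains of \<open>W\<close>
    without its top lies in \<open>?L (top W)\<close>.\<close>
  have top_strict: "f y < f (top W)" if "W \<in> ?C" "y \<in> W" "y \<noteq> top W" for W y
  proof -
    have "W \<subseteq> verts G" using that by (auto simp: complete_sub_def)
    then have "f y \<noteq> f (top W)" using top[OF that(1)] that inj by (auto dest: inj_onD)
    then show ?thesis using top[OF that(1)] that by force
  qed
  have fin_sphere: "finite (verts (unit_sphere G x))" for x
    using fin by (simp add: unit_sphere_def induced_def)
  have finL: "finite (?L x)" for x
    by (rule finite_subset[OF _ finite_complete_subs[OF fin_sphere]]) auto
  have L: "complete_sub G (insert x W) \<and> x \<notin> W \<and> finite W" if "x \<in> verts G" "W \<in> ?L x" for x W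
    using that complete_sub_unit_sphere[OF that(1)] finite_complete_sub[OF fin_sphere] by auto
  have top_insert: "top (insert x W) = x" if "x \<in> verts G" "W \<in> ?L x" for x W
  proof (rule ccontr)
    assume ne: "top (insert x W) \<noteq> x"
    have "insert x W \<in> ?C" using L[OF that] by simp
    from top[OF this] ne have "top (insert x W) \<in> W" "f x \<le> f (top (insert x W))" by auto
    with that(2) show False by force
  qed
  have "(\<Sum>x\<in>verts G. alternating_sum (?L x)) =
      (\<Sum>(x, W)\<in>Sigma (verts G) ?L. (-1) ^ card W)"
    unfolding alternating_sum_def using fin finL by (subst sum.Sigma) auto
  also have "\<dots> = (\<Sum>W\<in>?C. - ((-1) ^ card W))"
  proof (rule sum.reindex_bij_witness[where j = "\<lambda>(x, W). insert x W"
        and i = "\<lambda>W. (top W, W - {top W})"], goal_cases)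
    case (1 a)
    then show ?case using top_insert L by auto
  next
    case (2 a)
    then show ?case using L by auto
  next
    case (3 W)
    then show ?case using top by auto
  next
    case (4 W)
    have "top W \<in> verts G" using 4 top[OF 4] by (auto simp: complete_sub_def)
    then show ?case using 4 top[OF 4] top_strict[OF 4]
      by (auto simp: complete_sub_unit_sphere insert_absorb)
  next
    case (5 a)
    then show ?case using L by (auto)
  qed
  finally show ?thesis
    unfolding euler_char_eq_alternating_sum[OF fin] by (simp add: alternating_sum_def sum_negf)
qed

section \<open>Supports of complete subgraphs of the completion\<close>

fun carrier :: "'a completion_vertex \<Rightarrow> 'a set" where
  "carrier (Mixed_Edge e) = e"
| "carrier (Apex \<sigma>) = \<sigma>"

definition support :: "'a completion_vertex set \<Rightarrow> 'a set" where
  "support C = (\<Union>p\<in>C. carrier p)"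

lemma support_simps [simp]:
  "support {} = {}" "support (insert p C) = carrier p \<union> support C"
  by (auto simp: support_def)

lemma carrier_subset_support: "p \<in> C \<Longrightarrow> carrier p \<subseteq> support C"
  by (auto simp: support_def)

text \<open>An unordered pair may match the comprehension in either order. The relation behind the
  hypersurface edges is symmetric, so there the disjunction collapses.\<close>

lemma doubleton_mem_iff: "{a, b} \<in> {{x, y} | x y. R x y} \<longleftrightarrow> R a b \<or> R b a"
  by (auto simp: doubleton_eq_iff)

lemma verts_hypersurface: "verts (hypersurface H g) = {e \<in> edges H. mixed g e}"
  by (simp add: hypersurface_def)

lemma edge_hypersurface_iff:
  "{e, e'} \<in> edges (hypersurface H g) \<longleftrightarrow>
     e \<in> edges H \<and> mixed g e \<and> e' \<in> edges H \<and> mixed g e' \<and> e \<noteq> e' \<and>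
       (\<exists>T. complete_sub H T \<and> card T = 3 \<and> mixed g T \<and> e \<subseteq> T \<and> e' \<subseteq> T)"
  unfolding hypersurface_def snd_conv doubleton_mem_iff by blast

lemma edge_completion_simps:
  "{Mixed_Edge e, Mixed_Edge e'} \<in> edges (completion H g) \<longleftrightarrow>
     {e, e'} \<in> edges (hypersurface H g)"
  "{Mixed_Edge e, Apex \<sigma>} \<in> edges (completion H g) \<longleftrightarrow>
     e \<in> edges H \<and> mixed g e \<and> \<sigma> \<in> pyramid_bases H g \<and> e \<subseteq> \<sigma>"
  "{Apex \<sigma>, Mixed_Edge e} \<in> edges (completion H g) \<longleftrightarrow>
     e \<in> edges H \<and> mixed g e \<and> \<sigma> \<in> pyramid_bases H g \<and> e \<subseteq> \<sigma>"
  "{Apex \<tau>, Apex \<sigma>} \<in> edges (completion H g) \<longleftrightarrow>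
     \<tau> \<in> pyramid_bases H g \<and> \<sigma> \<in> pyramid_bases H g \<and> (\<tau> \<subset> \<sigma> \<or> \<sigma> \<subset> \<tau>)"
  by (auto simp: completion_def verts_hypersurface doubleton_eq_iff insert_commute)

lemma verts_completion_simps:
  "Mixed_Edge e \<in> verts (completion H g) \<longleftrightarrow> e \<in> edges H \<and> mixed g e"
  "Apex \<sigma> \<in> verts (completion H g) \<longleftrightarrow> \<sigma> \<in> pyramid_bases H g"
  by (auto simp: completion_def hypersurface_def)

lemma mixed_pyramid_base: "\<sigma> \<in> pyramid_bases H g \<Longrightarrow> mixed g \<sigma>"
proof -
  assume "\<sigma> \<in> pyramid_bases H g"
  then have "card {x \<in> \<sigma>. g x > 0} \<noteq> 0" "card {x \<in> \<sigma>. g x < 0} \<noteq> 0"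
    by (auto simp: pyramid_bases_def)
  then have "{x \<in> \<sigma>. g x > 0} \<noteq> {}" "{x \<in> \<sigma>. g x < 0} \<noteq> {}" by fastforce+
  then show ?thesis by (auto simp: mixed_def)
qed

lemma complete_pyramid_base: "\<sigma> \<in> pyramid_bases H g \<Longrightarrow> complete_sub H \<sigma>"
  by (simp add: pyramid_bases_def)

lemma mixed_mono: "mixed g U \<Longrightarrow> U \<subseteq> W \<Longrightarrow> mixed g W"
  by (auto simp: mixed_def)

lemma mixed_edgeE:
  assumes "finite_simple_graph H" "e \<in> edges H" "mixed g e"
  obtains a b where "e = {a, b}" "g a > 0" "g b < 0"
proof -
  obtain a b where ab: "a \<in> e" "g a > 0" "b \<in> e" "g b < 0" using assms(3) by (auto simp: mixed_def)
  moreover have "card e = 2" using assms by (auto simp: finite_simple_graph_def)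
  ultimately have "e = {a, b}" by (auto simp: card_2_iff)
  then show thesis using that ab by blast
qed

lemma complete_sub_edge:
  assumes "finite_simple_graph H" "e \<in> edges H"
  shows "complete_sub H e"
proof -
  have "card e = 2" "e \<subseteq> verts H" using assms by (auto simp: finite_simple_graph_def)
  then obtain a b where "e = {a, b}" "a \<noteq> b" by (auto simp: card_2_iff)
  then show ?thesis using assms(2) \<open>e \<subseteq> verts H\<close> by (auto simp: complete_sub_def insert_commute)
qed

lemma complete_sub_mixed_carrier:
  assumes "finite_simple_graph H" "p \<in> verts (completion H g)"
  shows "complete_sub H (carrier p) \<and> mixed g (carrier p)"
  using assms
  by (cases p)
    (auto simp: verts_completion_simps intro: complete_sub_edge mixed_pyramid_base
      complete_pyramid_base)

text \<open>For two mixed edges \<open>T\<close> is their common mixed triangle; if an apex is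
  involved, it is the larger of the two carriers.\<close>

lemma adjacent_carriers_in_complete_sub:
  assumes "{p, q} \<in> edges (completion H g)"
  obtains T where "complete_sub H T" "carrier p \<subseteq> T" "carrier q \<subseteq> T"
proof -
  have "\<exists>T. complete_sub H T \<and> carrier p \<subseteq> T \<and> carrier q \<subseteq> T"
    using assms
    by (cases p; cases q)
      (auto simp: edge_completion_simps edge_hypersurface_iff dest!: complete_pyramid_base)
  then show thesis using that by blast
qed

text \<open>Completeness is a condition on pairs. Two vertices of the support lie in the carriers of
  two members of \<open>C\<close>, which are equal or adjacent, so some complete subgraph of
  \<open>H\<close> contains both carriers.\<close>

lemma complete_sub_support:
  assumes H: "finite_simple_graph H" and C: "complete_sub (completion H g) C"
  shows "complete_sub H (support C)"
proof -
  have *: "\<exists>T. complete_sub H T \<and> carrier p \<subseteq> T \<and> carrier q \<subseteq> T" if "p \<in> C" "q \<in> C" for p q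
  proof (cases "p = q")
    case True
    then show ?thesis using complete_sub_mixed_carrier[OF H] that C
      by (metis complete_sub_def order_refl subsetD)
  next
    case False
    then have "{p, q} \<in> edges (completion H g)" using C that by (auto simp: complete_sub_def)
    then show ?thesis by (elim adjacent_carriers_in_complete_sub) auto
  qed
  show ?thesis
    unfolding complete_sub_def
  proof (intro conjI ballI impI subsetI)
    fix x assume "x \<in> support C"
    then show "x \<in> verts H" using * by (fastforce simp: support_def complete_sub_def)
  next
    fix x y assume "x \<in> support C" "y \<in> support C" "x \<noteq> y"
    then obtain p q where "p \<in> C" "q \<in> C" "x \<in> carrier p" "y \<in> carrier q"
      by (auto simp: support_def)
    then show "{x, y} \<in> edges H" using *[of p q] \<open>x \<noteq> y\<close> unfolding complete_sub_def by blast
  qed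
qed

lemma mixed_support:
  assumes "finite_simple_graph H" "complete_sub (completion H g) C" "C \<noteq> {}"
  shows "mixed g (support C)"
proof -
  obtain p where p: "p \<in> C" using assms(3) by auto
  then have "mixed g (carrier p)"
    using complete_sub_mixed_carrier[OF assms(1)] assms(2) by (auto simp: complete_sub_def)
  then show ?thesis using mixed_mono carrier_subset_support[OF p] by blast
qed

lemma finite_pyramid_bases: "finite (verts H) \<Longrightarrow> finite (pyramid_bases H g)"
  by (rule finite_subset[OF _ finite_complete_subs]) (auto simp: pyramid_bases_def)

lemma finite_verts_completion:
  assumes "finite_simple_graph H"
  shows "finite (verts (completion H g))"
proof -
  have "finite (verts H)" "edges H \<subseteq> Pow (verts H)"
    using assms by (auto simp: finite_simple_graph_def)
  then have "finite (edges H)" by (meson finite_Pow_iff finite_subset)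
  then show ?thesis using finite_pyramid_bases[OF \<open>finite (verts H)\<close>]
    by (simp add: completion_def hypersurface_def)
qed

text \<open>Apexes are adjacent only when their bases are strictly nested, so the bases occurring in
  \<open>C\<close> form a chain. The largest contains the carrier of every other member and is
  therefore the whole support.\<close>

lemma apex_support_mem:
  assumes H: "finite_simple_graph H" and C: "complete_sub (completion H g) C"
    and apex: "Apex \<rho> \<in> C"
  shows "Apex (support C) \<in> C"
proof -
  let ?Y = "{\<sigma>. Apex \<sigma> \<in> C}"
  have "finite C" using finite_complete_sub[OF finite_verts_completion[OF H] C] .
  then have "finite (carrier ` C)" by simp
  moreover have "?Y \<subseteq> carrier ` C" by force
  ultimately have "finite ?Y" by (rule rev_finite_subset)
  then obtain \<sigma> where \<sigma>: "Apex \<sigma> \<in> C" "\<And>\<tau>. Apex \<tau> \<in> C \<Longrightarrow> \<not> \<sigma> \<subset> \<tau>"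
    using finite_has_maximal[of ?Y] apex by (auto simp: psubset_eq)
  have "carrier p \<subseteq> \<sigma>" if "p \<in> C" for p
  proof (cases "p = Apex \<sigma>")
    case False
    then have "{p, Apex \<sigma>} \<in> edges (completion H g)"
      using C that \<sigma>(1) unfolding complete_sub_def by blast
    then show ?thesis using \<sigma>(2) that by (cases p) (auto simp: edge_completion_simps)
  qed simp
  then have "support C = \<sigma>" using carrier_subset_support[OF \<sigma>(1)] by (auto simp: support_def)
  then show ?thesis using \<sigma>(1) by simp
qed

section \<open>Complete subgraphs of the completion without an apex\<close>

lemma adjacent_mixed_edges_share_vertex:
  assumes "{{a, b}, {a', b'}} \<in> edges (hypersurface H g)"
    "g a > 0" "g b < 0" "g a' > 0" "g b' < 0"
  shows "a = a' \<or> b = b'"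
proof (rule ccontr)
  assume ne: "\<not> (a = a' \<or> b = b')"
  \<comment> \<open>Two disjoint mixed edges have four distinct ends, too many for the triangle that
    makes them adjacent.\<close>
  obtain T where "card T = 3" "{a, b, a', b'} \<subseteq> T"
    using assms(1) by (auto simp: edge_hypersurface_iff)
  moreover have "a \<noteq> b" "a \<noteq> b'" "a' \<noteq> b" "a' \<noteq> b'" using assms(2-5) by auto
  then have "card {a, b, a', b'} = 4" using ne by auto
  ultimately show False using card_mono[of T "{a, b, a', b'}"] by (auto simp: card_ge_0_finite)
qed

text \<open>The complete subgraphs of a product \<open>K\<^sub>s \<times> K\<^sub>t\<close> lie in one row or in one column.\<close>

lemma complete_mixed_edges_common_vertex:
  assumes H: "finite_simple_graph H"
    and X: "\<And>e. e \<in> X \<Longrightarrow> e \<in> edges H \<and> mixed g e"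
    and adj: "\<And>e e'. e \<in> X \<Longrightarrow> e' \<in> X \<Longrightarrow> e \<noteq> e' \<Longrightarrow> {e, e'} \<in> edges (hypersurface H g)"
  shows "\<exists>a. \<forall>e\<in>X. a \<in> e"
proof (rule ccontr)
  assume no: "\<nexists>a. \<forall>e\<in>X. a \<in> e"
  have E: "\<exists>a b. e = {a, b} \<and> g a > 0 \<and> g b < 0" if "e \<in> X" for e
    using X[OF that] mixed_edgeE[OF H] by metis
  have "X \<noteq> {}" using no by auto
  then obtain a b where ab: "{a, b} \<in> X" "g a > 0" "g b < 0" using E by blast
  \<comment> \<open>Compared with \<open>{a, b}\<close>, the edge avoiding \<open>a\<close> must
    share \<open>b\<close>, and the edge avoiding \<open>b\<close> must share \<open>a\<close>.
    These two edges then share no end of either sign.\<close>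
  obtain e' where "e' \<in> X" "a \<notin> e'" using no by blast
  then obtain a' b' where e': "{a', b'} \<in> X" "g a' > 0" "g b' < 0" "a \<noteq> a'" using E by blast
  obtain e'' where "e'' \<in> X" "b \<notin> e''" using no by blast
  then obtain a'' b'' where e'': "{a'', b''} \<in> X" "g a'' > 0" "g b'' < 0" "b \<noteq> b''"
    using E by blast
  have share: "u = u' \<or> v = v'"
    if "{u, v} \<in> X" "{u', v'} \<in> X" "g u > 0" "g v < 0" "g u' > 0" "g v' < 0" for u v u' v'
  proof (cases "{u, v} = {u', v'}")
    case True
    then show ?thesis using that by (auto simp: doubleton_eq_iff)
  next
    case False
    then show ?thesis using adjacent_mixed_edges_share_vertex[OF adj[OF that(1,2)]] that(3-6) by simp
  qed
  show False
    using share[OF ab(1) e'(1)] share[OF ab(1) e''(1)] share[OF e'(1) e''(1)] ab e' e'' by simp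
qed

text \<open>All members are mixed edges through one vertex \<open>a\<close>, so every other support
  vertex has the sign opposite to \<open>a\<close>. Thus \<open>a\<close> is alone with its sign,
  which excludes a base, and every mixed edge inside the support is a spoke from \<open>a\<close>,
  which determines \<open>C\<close>.\<close>

lemma support_without_apex:
  assumes H: "finite_simple_graph H" and C: "complete_sub (completion H g) C" "C \<noteq> {}"
    and no_apex: "\<And>\<sigma>. Apex \<sigma> \<notin> C"
  shows "support C \<notin> pyramid_bases H g"
    and "C = Mixed_Edge ` {e \<in> edges H. mixed g e \<and> e \<subseteq> support C}"
proof -
  define X where "X = {e. Mixed_Edge e \<in> C}"
  have CX: "C = Mixed_Edge ` X"
  proof
    show "C \<subseteq> Mixed_Edge ` X"
    proof
      fix p assume "p \<in> C"
      then show "p \<in> Mixed_Edge ` X" using no_apex by (cases p) (auto simp: X_def)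
    qed
  qed (auto simp: X_def)
  have X: "e \<in> edges H \<and> mixed g e" if "e \<in> X" for e
    using that C(1) unfolding X_def complete_sub_def verts_completion_simps(1)[symmetric] by blast
  have adj: "{e, e'} \<in> edges (hypersurface H g)" if "e \<in> X" "e' \<in> X" "e \<noteq> e'" for e e'
    using that C(1) unfolding X_def complete_sub_def edge_completion_simps(1)[symmetric] by simp
  have "\<exists>a. \<forall>e\<in>X. a \<in> e"
    by (rule complete_mixed_edges_common_vertex[OF H]) (use X adj in auto)
  then obtain a where a: "\<And>e. e \<in> X \<Longrightarrow> a \<in> e" by blast
  have supp: "support C = \<Union>X" by (auto simp: support_def CX)
  \<comment> \<open>The product condition treats both possible signs of \<open>a\<close> at
    once.\<close>
  have E: "\<exists>b. e = {a, b} \<and> g a * g b < 0" if e: "e \<in> X" for e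
  proof -
    obtain u v where uv: "e = {u, v}" "g u > 0" "g v < 0"
      using X[OF e] mixed_edgeE[OF H, of e g] by blast
    then consider "a = u" | "a = v" using a[OF e] by auto
    then show ?thesis
    proof cases
      case 1
      then have "e = {a, v} \<and> g a * g v < 0" using uv by (simp add: mult_pos_neg)
      then show ?thesis ..
    next
      case 2
      then have "e = {a, u} \<and> g a * g u < 0" using uv by (simp add: mult_neg_pos insert_commute)
      then show ?thesis ..
    qed
  qed
  have opp: "g a * g b < 0" if b: "b \<in> support C" "b \<noteq> a" for b
  proof -
    obtain e where "e \<in> X" "b \<in> e" using b(1) supp by auto
    then show ?thesis using E[of e] b(2) by auto
  qed
  obtain e0 where "e0 \<in> X" using C(2) CX by auto
  with E[of e0] have "g a \<noteq> 0" by auto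
  then consider "g a > 0" | "g a < 0" by linarith
  then have "{x \<in> support C. g x > 0} \<subseteq> {a} \<or> {x \<in> support C. g x < 0} \<subseteq> {a}"
  proof cases
    case 1
    have "x = a" if "x \<in> support C" "g x > 0" for x
      using opp[of x] that 1 by (cases "x = a") (auto simp: mult_less_0_iff)
    then show ?thesis by blast
  next
    case 2
    have "x = a" if "x \<in> support C" "g x < 0" for x
      using opp[of x] that 2 by (cases "x = a") (auto simp: mult_less_0_iff)
    then show ?thesis by blast
  qed
  then have "card {x \<in> support C. g x > 0} \<le> 1 \<or> card {x \<in> support C. g x < 0} \<le> 1"
    using card_mono[of "{a}" "{x \<in> support C. g x > 0}"] card_mono[of "{a}" "{x \<in> support C. g x < 0}"]
    by auto
  then show "support C \<notin> pyramid_bases H g" by (auto simp: pyramid_bases_def)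
  \<comment> \<open>An edge avoiding \<open>a\<close> would have both ends of the sign opposite to
    \<open>a\<close> and so not be mixed. A spoke \<open>{a, b}\<close> is in \<open>X\<close>
    because the member that brings \<open>b\<close> into the support can only be that spoke.\<close>
  have "e \<in> X" if e: "e \<in> edges H" "mixed g e" "e \<subseteq> support C" for e
  proof -
    obtain u v where uv: "e = {u, v}" "g u > 0" "g v < 0" using mixed_edgeE[OF H e(1,2)] .
    have "a \<in> e"
    proof (rule ccontr)
      assume "a \<notin> e"
      then have "g a * g u < 0" "g a * g v < 0" using opp uv e(3) by auto
      then show False using uv by (auto simp: mult_less_0_iff)
    qed
    then obtain b where b: "e = {a, b}" "b \<noteq> a" using uv by force
    then have "b \<in> support C" using e(3) by auto
    then obtain e' where e': "e' \<in> X" "b \<in> e'" using supp by auto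
    then have "e' = {a, b}" using E[OF e'(1)] b(2) by auto
    then show "e \<in> X" using b e' by simp
  qed
  then have "X = {e \<in> edges H. mixed g e \<and> e \<subseteq> support C}"
    using X supp by auto
  then show "C = Mixed_Edge ` {e \<in> edges H. mixed g e \<and> e \<subseteq> support C}" using CX by simp
qed

section \<open>Alternating count of the complete subgraphs with a given support\<close>

abbreviation cliques_with_support ::
  "'a graph \<Rightarrow> ('a \<Rightarrow> real) \<Rightarrow> 'a set \<Rightarrow> 'a completion_vertex set set" where
  "cliques_with_support H g \<sigma> \<equiv> {C. complete_sub (completion H g) C \<and> support C = \<sigma>}"

text \<open>If the apex over the support were missing, there would be no apex at all, and then the
  support could not be a base.\<close>

lemma apex_mem_if_support_base:
  assumes H: "finite_simple_graph H" and C: "complete_sub (completion H g) C"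
    and \<sigma>: "\<sigma> \<in> pyramid_bases H g" and supp: "support C = \<sigma>"
  shows "Apex \<sigma> \<in> C"
proof (rule ccontr)
  assume "Apex \<sigma> \<notin> C"
  then have "\<And>\<rho>. Apex \<rho> \<notin> C" using apex_support_mem[OF H C] supp by blast
  moreover have "C \<noteq> {}" using mixed_pyramid_base[OF \<sigma>] supp by (auto simp: mixed_def)
  ultimately show False using support_without_apex(1)[OF H C] \<sigma> supp by blast
qed

text \<open>Removing \<open>Apex \<sigma>\<close> is a bijection onto the complete subgraphs with
  support strictly inside \<open>\<sigma>\<close>. By \<open>IH\<close> these sum to 1, for the
  empty one, minus the sum over the proper mixed subsets, which is
  \<open>1 - (-1) ^ card \<sigma>\<close>. The removed apex contributes the final minus
  sign.\<close>

lemma alternating_sum_cliques_with_support_base: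
  assumes H: "finite_simple_graph H" and \<sigma>: "\<sigma> \<in> pyramid_bases H g"
    and nz: "\<And>x. x \<in> verts H \<Longrightarrow> g x \<noteq> 0"
    and IH: "\<And>\<tau>. \<tau> \<subset> \<sigma> \<Longrightarrow> mixed g \<tau> \<Longrightarrow>
      alternating_sum (cliques_with_support H g \<tau>) = - ((-1) ^ card \<tau>)"
  shows "alternating_sum (cliques_with_support H g \<sigma>) = - ((-1) ^ card \<sigma>)"
proof -
  let ?B = "completion H g"
  let ?K = "{C. complete_sub ?B C \<and> support C \<subset> \<sigma>}"
  let ?D = "{\<tau>. \<tau> \<subset> \<sigma> \<and> mixed g \<tau>}"
  have fin: "finite (verts ?B)" using finite_verts_completion[OF H] .
  have finK: "finite ?K" by (rule finite_subset[OF _ finite_complete_subs[OF fin]]) auto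
  have \<sigma>H: "complete_sub H \<sigma>" "mixed g \<sigma>"
    using complete_pyramid_base[OF \<sigma>] mixed_pyramid_base[OF \<sigma>] by auto
  then have fin\<sigma>: "finite \<sigma>"
    using H finite_complete_sub unfolding finite_simple_graph_def by blast
  have not_apex: "Apex \<sigma> \<notin> C" if "C \<in> ?K" for C
    using that carrier_subset_support[of "Apex \<sigma>" C] by auto
  have cone: "insert (Apex \<sigma>) C \<in> cliques_with_support H g \<sigma>" if C: "C \<in> ?K" for C
  proof -
    have adj: "{p, Apex \<sigma>} \<in> edges ?B" if "p \<in> C" for p
    proof -
      have "carrier p \<subset> \<sigma>" "p \<in> verts ?B"
        using C that carrier_subset_support[OF that] by (auto simp: complete_sub_def)
      then show ?thesis using \<sigma> by (cases p) (auto simp: edge_completion_simps verts_completion_simps)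
    qed
    then have "{Apex \<sigma>, p} \<in> edges ?B" if "p \<in> C" for p using that by (simp add: insert_commute)
    then have "complete_sub ?B (insert (Apex \<sigma>) C)"
      using C adj \<sigma> by (auto simp: complete_sub_def verts_completion_simps)
    then show ?thesis using C by auto
  qed
  have unc: "C - {Apex \<sigma>} \<in> ?K" "Apex \<sigma> \<in> C" if C: "C \<in> cliques_with_support H g \<sigma>" for C
  proof -
    show "Apex \<sigma> \<in> C" using apex_mem_if_support_base[OF H _ \<sigma>] C by auto
    have sub: "complete_sub ?B (C - {Apex \<sigma>})" using C by (auto intro: complete_sub_subset)
    \<comment> \<open>If the support were still \<open>\<sigma>\<close>, the apex just removed would
      have to be present.\<close>
    moreover have "support (C - {Apex \<sigma>}) \<noteq> \<sigma>" using apex_mem_if_support_base[OF H sub \<sigma>] by auto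
    moreover have "support (C - {Apex \<sigma>}) \<subseteq> support C" by (auto simp: support_def)
    ultimately show "C - {Apex \<sigma>} \<in> ?K" using C by auto
  qed
  have "alternating_sum (cliques_with_support H g \<sigma>) = (\<Sum>C\<in>?K. - ((-1) ^ card C))"
    unfolding alternating_sum_def
  proof (rule sum.reindex_bij_witness[where i = "insert (Apex \<sigma>)" and j = "\<lambda>C. C - {Apex \<sigma>}"],
      goal_cases)
    case (1 C)
    then show ?case using unc(2)[of C] by auto
  next
    case (2 C)
    then show ?case using unc(1) by blast
  next
    case (3 C)
    then show ?case using not_apex by blast
  next
    case (4 C)
    then show ?case using cone by blast
  next
    case (5 C)
    have "finite C" using 5 finite_complete_sub[OF fin] by auto
    then have "card C = Suc (card (C - {Apex \<sigma>}))" using unc(2)[OF 5]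
      by (metis card_Suc_Diff1)
    then show ?case by simp
  qed
  also have "\<dots> = - alternating_sum ?K" by (simp add: alternating_sum_def sum_negf)
  \<comment> \<open>The empty complete subgraph is split off because its support is not mixed, so it
    belongs to no fibre over \<open>?D\<close>.\<close>
  also have "alternating_sum ?K = 1 + alternating_sum (?K - {{}})"
    using finK \<sigma>H(2) complete_sub_empty[of ?B]
    by (subst alternating_sum_def, subst sum.remove[of _ "{}"])
      (auto simp: alternating_sum_def mixed_def)
  also have "alternating_sum (?K - {{}}) = (\<Sum>\<tau>\<in>?D. alternating_sum (cliques_with_support H g \<tau>))"
  proof -
    have "{C \<in> ?K - {{}}. support C = \<tau>} = cliques_with_support H g \<tau>" if "\<tau> \<in> ?D" for \<tau>
      using that by (auto simp: mixed_def)
    moreover have "finite ?D" using fin\<sigma> by (auto intro: finite_subset[of _ "Pow \<sigma>"])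
    moreover have "support ` (?K - {{}}) \<subseteq> ?D" using mixed_support[OF H] by auto
    ultimately show ?thesis using finK sum.group[of "?K - {{}}" ?D support "\<lambda>C. (-1::int) ^ card C"]
      by (simp add: alternating_sum_def)
  qed
  also have "\<dots> = - alternating_sum ?D"
    using IH by (simp add: alternating_sum_def sum_negf)
  also have "alternating_sum ?D = 1 - (-1) ^ card \<sigma>"
    using \<sigma>H nz fin\<sigma> by (intro alternating_sum_mixed_subsets) (auto simp: complete_sub_def)
  finally show ?thesis by simp
qed

text \<open>A mixed set has at least one vertex of each sign, and a complete one that is not a base
  has fewer than two of some sign; that lone vertex is \<open>a\<close>.\<close>

lemma lone_sign_vertexE:
  assumes "finite \<sigma>" "complete_sub H \<sigma>" "mixed g \<sigma>" "\<sigma> \<notin> pyramid_bases H g"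
    and nz: "\<And>x. x \<in> \<sigma> \<Longrightarrow> g x \<noteq> 0"
  obtains a where "a \<in> \<sigma>" "\<sigma> \<noteq> {a}" "\<And>b. b \<in> \<sigma> \<Longrightarrow> b \<noteq> a \<Longrightarrow> g a * g b < 0"
proof -
  let ?P = "{x \<in> \<sigma>. g x > 0}" and ?N = "{x \<in> \<sigma>. g x < 0}"
  have "?P \<noteq> {}" "?N \<noteq> {}" using assms(3) by (auto simp: mixed_def)
  then have "card ?P > 0" "card ?N > 0" using assms(1) by (auto simp: card_gt_0_iff)
  moreover have "card ?P < 2 \<or> card ?N < 2" using assms(2,4) by (auto simp: pyramid_bases_def)
  ultimately have "card ?P = 1 \<or> card ?N = 1" by linarith
  then obtain a where a: "?P = {a} \<or> ?N = {a}" by (auto simp: card_1_singleton_iff)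
  then have "a \<in> \<sigma>" by auto
  moreover have "\<sigma> \<noteq> {a}" using assms(3) by (auto simp: mixed_def)
  moreover have "g a * g b < 0" if b: "b \<in> \<sigma>" "b \<noteq> a" for b
    using a
  proof
    assume P: "?P = {a}"
    then have "g a > 0" "\<not> g b > 0" using b by auto
    then show ?thesis using nz[OF b(1)] by (simp add: mult_less_0_iff)
  next
    assume N: "?N = {a}"
    then have "g a < 0" "\<not> g b < 0" using b by auto
    then show ?thesis using nz[OF b(1)] by (simp add: mult_less_0_iff)
  qed
  ultimately show thesis using that by blast
qed

text \<open>Here \<open>\<sigma>\<close> is a star around its lone vertex \<open>a\<close>. No apex
  can occur, so the spokes from \<open>a\<close> form the only complete subgraph with this support;
  it has \<open>card \<sigma> - 1\<close> members.\<close>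

lemma alternating_sum_cliques_with_support_star:
  assumes H: "finite_simple_graph H" and \<sigma>: "complete_sub H \<sigma>" "mixed g \<sigma>" "\<sigma> \<notin> pyramid_bases H g"
    and nz: "\<And>x. x \<in> verts H \<Longrightarrow> g x \<noteq> 0"
  shows "alternating_sum (cliques_with_support H g \<sigma>) = - ((-1) ^ card \<sigma>)"
proof -
  let ?B = "completion H g" and ?X = "{e \<in> edges H. mixed g e \<and> e \<subseteq> \<sigma>}"
  have fin: "finite \<sigma>"
    using H \<sigma>(1) finite_complete_sub unfolding finite_simple_graph_def by blast
  obtain a where a: "a \<in> \<sigma>" "\<sigma> \<noteq> {a}" "\<And>b. b \<in> \<sigma> \<Longrightarrow> b \<noteq> a \<Longrightarrow> g a * g b < 0"
  proof (rule lone_sign_vertexE[OF fin \<sigma>])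
    show "g x \<noteq> 0" if "x \<in> \<sigma>" for x using that nz \<sigma>(1) by (auto simp: complete_sub_def)
  qed blast
  have X: "?X = (\<lambda>b. {a, b}) ` (\<sigma> - {a})"
  proof (intro equalityI subsetI)
    fix e assume "e \<in> ?X"
    then obtain u v where uv: "e = {u, v}" "g u > 0" "g v < 0" "u \<in> \<sigma>" "v \<in> \<sigma>"
      using mixed_edgeE[OF H] by (metis (no_types, lifting) insert_subset mem_Collect_eq)
    have "a = u \<or> a = v" using a(3)[of u] a(3)[of v] uv by (auto simp: mult_less_0_iff)
    then show "e \<in> (\<lambda>b. {a, b}) ` (\<sigma> - {a})" using uv by force
  next
    fix e assume "e \<in> (\<lambda>b. {a, b}) ` (\<sigma> - {a})"
    then obtain b where b: "e = {a, b}" "b \<in> \<sigma>" "b \<noteq> a" by auto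
    then have "{a, b} \<in> edges H" using \<sigma>(1) a(1) by (auto simp: complete_sub_def)
    then show "e \<in> ?X" using b a(1) a(3)[OF b(2,3)] by (auto simp: mixed_def mult_less_0_iff)
  qed
  have complete: "complete_sub ?B (Mixed_Edge ` ?X)"
  proof -
    have "{e, e'} \<in> edges (hypersurface H g)" if e: "e \<in> ?X" "e' \<in> ?X" "e \<noteq> e'" for e e'
    proof -
      obtain b b' where b: "e = {a, b}" "e' = {a, b'}" "b \<in> \<sigma>" "b' \<in> \<sigma>" "b \<noteq> a" "b' \<noteq> a" "b \<noteq> b'"
        using e unfolding X by auto
      \<comment> \<open>The triangle on \<open>a\<close> and the two outer ends witnesses that two
        spokes are adjacent.\<close>
      have "complete_sub H {a, b, b'}" using complete_sub_subset[OF \<sigma>(1)] a(1) b by auto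
      moreover have "card {a, b, b'} = 3" using b by auto
      moreover have "mixed g {a, b, b'}" using e(1) b(1) by (auto elim: mixed_mono)
      ultimately show ?thesis
        using e b by (auto simp: edge_hypersurface_iff intro!: exI[of _ "{a, b, b'}"])
    qed
    then show ?thesis
      unfolding complete_sub_def by (auto simp: verts_completion_simps edge_completion_simps)
  qed
  have "support (Mixed_Edge ` ?X) = \<sigma>"
    unfolding X support_def using a(1,2) by auto
  then have "cliques_with_support H g \<sigma> = {Mixed_Edge ` ?X}"
  proof (intro equalityI subsetI, goal_cases)
    case (1 C)
    then have C: "complete_sub ?B C" "support C = \<sigma>" by auto
    then have "C \<noteq> {}" using \<sigma>(2) by (auto simp: mixed_def)
    moreover have "Apex \<rho> \<notin> C" for \<rho>
      using apex_support_mem[OF H C(1)] C \<sigma>(3)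
      by (metis complete_sub_def subsetD verts_completion_simps(2))
    ultimately show ?case using support_without_apex(2)[OF H C(1)] C(2) by auto
  qed (use complete in auto)
  moreover have "card (Mixed_Edge ` ?X) = card \<sigma> - 1"
  proof -
    have "inj_on (\<lambda>b. {a, b}) (\<sigma> - {a})" by (auto simp: inj_on_def doubleton_eq_iff)
    then have "card ?X = card \<sigma> - 1" unfolding X using a(1) by (simp add: card_image)
    then show ?thesis by (simp add: card_image inj_on_def)
  qed
  moreover obtain k where "card \<sigma> = Suc k" using a(1) fin
    by (metis card_gt_0_iff empty_iff gr0_implies_Suc)
  ultimately show ?thesis by (simp add: alternating_sum_def)
qed

text \<open>Strong induction on the size: a base needs the result for all its proper mixed subsets,
  whether bases or stars, while a star is settled directly.\<close>

lemma alternating_sum_cliques_with_support: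
  assumes H: "finite_simple_graph H" and nz: "\<And>x. x \<in> verts H \<Longrightarrow> g x \<noteq> 0"
    and "complete_sub H \<sigma>" "mixed g \<sigma>"
  shows "alternating_sum (cliques_with_support H g \<sigma>) = - ((-1) ^ card \<sigma>)"
  using assms(3,4)
proof (induction "card \<sigma>" arbitrary: \<sigma> rule: less_induct)
  case less
  have "finite \<sigma>"
    using H less.prems(1) finite_complete_sub unfolding finite_simple_graph_def by blast
  show ?case
  proof (cases "\<sigma> \<in> pyramid_bases H g")
    case True
    then show ?thesis
    proof (rule alternating_sum_cliques_with_support_base[OF H _ nz])
      fix \<tau> assume "\<tau> \<subset> \<sigma>" "mixed g \<tau>"
      moreover from this have "card \<tau> < card \<sigma>" "complete_sub H \<tau>"
        using \<open>finite \<sigma>\<close> psubset_card_mono complete_sub_subset[OF less.prems(1)] by auto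
      ultimately show "alternating_sum (cliques_with_support H g \<tau>) = - ((-1) ^ card \<tau>)"
        by (intro less.hyps)
    qed
  next
    case False
    with less.prems show ?thesis
      by (intro alternating_sum_cliques_with_support_star[OF H _ _ _ nz])
  qed
qed

text \<open>Group the nonempty complete subgraphs of the completion by support. The minus sign of
  each fibre cancels the one relating \<open>euler_char\<close> to
  \<open>alternating_sum\<close>.\<close>

lemma euler_char_completion:
  assumes H: "finite_simple_graph H" and nz: "\<And>x. x \<in> verts H \<Longrightarrow> g x \<noteq> 0"
  shows "euler_char (completion H g) = alternating_sum {\<sigma>. complete_sub H \<sigma> \<and> mixed g \<sigma>}"
proof -
  let ?B = "completion H g"
  let ?C = "{C. complete_sub ?B C \<and> C \<noteq> {}}" and ?D = "{\<sigma>. complete_sub H \<sigma> \<and> mixed g \<sigma>}"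
  have fin: "finite (verts ?B)" using finite_verts_completion[OF H] .
  have "finite ?C" by (rule finite_subset[OF _ finite_complete_subs[OF fin]]) auto
  moreover have "finite ?D"
    by (rule finite_subset[OF _ finite_complete_subs[of H]])
      (use H in \<open>auto simp: finite_simple_graph_def\<close>)
  moreover have "support ` ?C \<subseteq> ?D" using complete_sub_support[OF H] mixed_support[OF H] by auto
  ultimately have "alternating_sum ?C = (\<Sum>\<sigma>\<in>?D. \<Sum>C | C \<in> ?C \<and> support C = \<sigma>. (-1) ^ card C)"
    unfolding alternating_sum_def by (simp only: sum.group)
  also have "\<dots> = (\<Sum>\<sigma>\<in>?D. alternating_sum (cliques_with_support H g \<sigma>))"
  proof (rule sum.cong[OF refl])
    fix \<sigma> assume "\<sigma> \<in> ?D"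
    then have "{C. C \<in> ?C \<and> support C = \<sigma>} = cliques_with_support H g \<sigma>"
      by (auto simp: mixed_def)
    then show "(\<Sum>C | C \<in> ?C \<and> support C = \<sigma>. (-1) ^ card C) =
        alternating_sum (cliques_with_support H g \<sigma>)" by (simp add: alternating_sum_def)
  qed
  also have "\<dots> = - alternating_sum ?D"
    using alternating_sum_cliques_with_support[OF H nz]
    by (simp add: alternating_sum_def sum_negf)
  finally show ?thesis unfolding euler_char_eq_alternating_sum[OF fin] by linarith
qed

section \<open>Geometric graphs and the averaged formula\<close>

lemma euler_char_unit_sphere_geometric:
  assumes "geometric_graph d G" "x \<in> verts G"
  shows "euler_char (unit_sphere G x) = 1 - (-1) ^ d"
  \<comment> \<open>In the base case the prescribed value 2 equals \<open>1 - (-1) ^ 1\<close>, so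
    one formula covers both rules.\<close>
  using assms by (auto elim: geometric_graph.cases)

text \<open>Geometricity fixes the sum over all complete subgraphs of the unit sphere as
  \<open>(-1) ^ d\<close>. Splitting these by sign adds 1 for the empty set, and the mixed ones give
  the Euler characteristic of \<open>B_graph\<close>.\<close>

lemma alternating_sum_below_above:
  assumes G: "finite_simple_graph G" "inj_on f (verts G)" and d: "geometric_graph d G"
    and x: "x \<in> verts G"
  shows "alternating_sum {W. complete_sub (unit_sphere G x) W \<and> (\<forall>y\<in>W. f y - f x < 0)} +
    alternating_sum {W. complete_sub (unit_sphere G x) W \<and> (\<forall>y\<in>W. f y - f x > 0)} =
    1 + (-1) ^ d - euler_char (B_graph G f x)"
proof -
  let ?H = "unit_sphere G x"
  have H: "finite_simple_graph ?H" using finite_simple_graph_unit_sphere[OF G(1)] .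
  then have fin: "finite (verts ?H)" by (simp add: finite_simple_graph_def)
  have nz: "f y - f x \<noteq> 0" if "y \<in> verts ?H" for y
  proof -
    have "y \<in> verts G" "y \<noteq> x" using that by (auto simp: unit_sphere_def induced_def)
    then show ?thesis using inj_on_eq_iff[OF G(2), of y x] x by simp
  qed
  have "alternating_sum {W. complete_sub ?H W} = (-1) ^ d"
    using euler_char_unit_sphere_geometric[OF d x] euler_char_eq_one_minus[OF fin] by linarith
  moreover have "alternating_sum {W. complete_sub ?H W} + 1 =
      alternating_sum {W \<in> {W. complete_sub ?H W}. \<forall>y\<in>W. f y - f x > 0} +
      alternating_sum {W \<in> {W. complete_sub ?H W}. \<forall>y\<in>W. f y - f x < 0} +
      alternating_sum {W \<in> {W. complete_sub ?H W}. mixed (\<lambda>y. f y - f x) W}"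
  proof (rule alternating_sum_split_by_sign[OF finite_complete_subs[OF fin], where g = "\<lambda>y. f y - f x"])
    show "f y - f x \<noteq> 0" if "W \<in> {W. complete_sub ?H W}" "y \<in> W" for W y
      using that nz[of y] by (auto simp: complete_sub_def)
  qed (simp add: complete_sub_empty)
  moreover have "euler_char (B_graph G f x) =
      alternating_sum {W. complete_sub ?H W \<and> mixed (\<lambda>y. f y - f x) W}"
    unfolding B_graph_def using H nz by (rule euler_char_completion)
  ultimately show ?thesis unfolding mem_Collect_eq by linarith
qed

theorem corollary9:
  fixes G :: "'a graph" and f :: "'a \<Rightarrow> real" and d :: nat
  assumes "finite_simple_graph G"
    and "d \<ge> 1"
    and "geometric_graph d G"
    and "inj_on f (verts G)"
  shows "real_of_int (euler_char G) =
           (\<Sum>x\<in>verts G. (1 + (-1) ^ d) / 2 - real_of_int (euler_char (B_graph G f x)) / 2)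
       \<and> (odd d \<longrightarrow> real_of_int (euler_char G) =
           - (\<Sum>x\<in>verts G. real_of_int (euler_char (B_graph G f x)) / 2))
       \<and> (even d \<longrightarrow> real_of_int (euler_char G) =
           (\<Sum>x\<in>verts G. 1 - real_of_int (euler_char (B_graph G f x)) / 2))"
proof -
  have fin: "finite (verts G)" using assms(1) by (simp add: finite_simple_graph_def)
  let ?L = "\<lambda>x. alternating_sum {W. complete_sub (unit_sphere G x) W \<and> (\<forall>y\<in>W. f y - f x < 0)}"
  let ?U = "\<lambda>x. alternating_sum {W. complete_sub (unit_sphere G x) W \<and> (\<forall>y\<in>W. f y - f x > 0)}"
  let ?b = "\<lambda>x. euler_char (B_graph G f x)"
  have inj: "inj_on (\<lambda>x. - f x) (verts G)" using assms(4) by (simp add: inj_on_def)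
  have neg: "- f y - - f x < 0 \<longleftrightarrow> f y - f x > 0" for x y by linarith
  have "euler_char G = sum ?L (verts G)" by (rule poincare_hopf[OF fin assms(4)])
  \<comment> \<open>Passing to \<open>- f\<close> exchanges the lower and the upper part of each
    unit sphere.\<close>
  moreover have "euler_char G = sum ?U (verts G)"
    using poincare_hopf[OF fin inj] unfolding neg .
  ultimately have "2 * euler_char G = (\<Sum>x\<in>verts G. ?L x + ?U x)"
    unfolding sum.distrib by linarith
  also have "\<dots> = (\<Sum>x\<in>verts G. 1 + (-1) ^ d - ?b x)"
    by (rule sum.cong[OF refl alternating_sum_below_above[OF assms(1,4,3)]])
  finally have "real_of_int (2 * euler_char G) = real_of_int (\<Sum>x\<in>verts G. 1 + (-1) ^ d - ?b x)"
    by (rule arg_cong)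
  then have "real_of_int (euler_char G) = (\<Sum>x\<in>verts G. 1 + (-1) ^ d - real_of_int (?b x)) / 2"
    by simp
  also have "\<dots> = (\<Sum>x\<in>verts G. (1 + (-1) ^ d) / 2 - real_of_int (?b x) / 2)"
    unfolding sum_divide_distrib diff_divide_distrib ..
  finally have main: "real_of_int (euler_char G) =
      (\<Sum>x\<in>verts G. (1 + (-1) ^ d) / 2 - real_of_int (?b x) / 2)" .
  moreover have "real_of_int (euler_char G) = - (\<Sum>x\<in>verts G. real_of_int (?b x) / 2)" if "odd d"
    unfolding main sum_negf[symmetric] using that by simp
  moreover have "real_of_int (euler_char G) = (\<Sum>x\<in>verts G. 1 - real_of_int (?b x) / 2)" if "even d"
    unfolding main using that by simp
  ultimately show ?thesis by blast
qed

end
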